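(* Let $m\ge1$, and let $p$ be an $m$-closed orthogonal circle pattern, with circle centers $t$, such that $p_{i,0}=0$ for all $i\in\mathbb Z$. Assume that the pattern can be propagated forward from its initial data up to and including the row $p_{m-1}=(p_{i,m-1})_{i\in\mathbb Z}$ (that is, $m-2$ steps $(p_{j-1},p_j)\mapsto(p_j,p_{j+1})$ starting from $(p_0,p_1)$). Then, for all $i\in\mathbb Z$, $$p_{i,m-1}=\Bigl(\frac1m\sum_{\ell=0}^{m-1}\frac{1}{p_{\ell,1}}\Bigr)^{-1}=\Bigl(\frac1m\sum_{\ell=0}^{m-1}\frac{1}{t_{\ell,0}}\Bigr)^{-1}.$$
   Context: $\hat{\mathbb C}=\mathbb C\cup\{\infty\}$ is identified with $\mathbb{CP}^1$. A (square grid) circle pattern is a map $p$ to $\hat{\mathbb C}$ together with circles $c_{i,j}$ (Euclidean circles or lines) such that $p_{i,j},p_{i+1,j},p_{i+1,j+1},p_{i,j+1}\in c_{i,j}$; $t_{i,j}$ is the center of $c_{i,j}$. It is orthogonal if adjacent circles ($c_{i,j},c_{i+1,j}$ and $c_{i,j},c_{i,j+1}$) intersect orthogonally. It is $m$-closed if $p_{i+m,j}=p_{i,j}$ and $c_{i+m,j}=c_{i,j}$ for all $i,j$. Propagation: setting $\tilde z_{2i,2j}=p_{i,j}$ and $\tilde z_{2i+1,2j+1}=t_{i,j}$, the map $z_{i,j}=\tilde z_{i-j,i+j}$ satisfies $\frac{(z_{i,j}-z_{i+1,j})(z_{i+1,j+1}-z_{i,j+1})}{(z_{i+1,j}-z_{i+1,j+1})(z_{i,j+1}-z_{i,j})}=-1$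 on every quad, so that each row $\tilde z_{j+2}$ is determined by $(\tilde z_j,\tilde z_{j+1})$. The initial data are $\tilde z_0$ (the points $p_{i,0}$) and $\tilde z_1$ (the centers $t_{i,0}$), and only rows with second index $\ge0$ are considered (backward propagation from a constant row is undefined). Standing assumption: the data are as generic as possible given the initial singularity. *)

theory Defs
  imports "HOL-Analysis.Analysis"
begin

datatype riemann_sphere = Fin complex | Infty

text \<open>
  Addition makes \<open>Infty\<close> absorbing, so that the library's \<open>sum\<close> applies. The junk value
  \<open>Infty + Infty = Infty\<close> plays no role below: reciprocals of non-zero points are finite.
\<close>

instantiation riemann_sphere :: comm_monoid_add
begin

definition zero_riemann_sphere :: riemann_sphere where
  "0 = Fin 0"

fun plus_riemann_sphere :: "riemann_sphere \<Rightarrow> riemann_sphere \<Rightarrow> riemann_sphere" where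
  "Fin x + Fin y = Fin (x + y)"
| "Infty + y = Infty"
| "Fin x + Infty = Infty"

instance
proof
  fix a b c :: riemann_sphere
  show "a + b + c = a + (b + c)" by (cases a; cases b; cases c) (auto simp: add.assoc)
  show "a + b = b + a" by (cases a; cases b) (auto simp: add.commute)
  show "0 + a = a" by (cases a) (auto simp: zero_riemann_sphere_def)
qed

end

fun recip :: "riemann_sphere \<Rightarrow> riemann_sphere" where
  "recip (Fin x) = (if x = 0 then Infty else Fin (1 / x))"
| "recip Infty = Fin 0"

text \<open>Only used with a non-zero scalar.\<close>

fun scale :: "complex \<Rightarrow> riemann_sphere \<Rightarrow> riemann_sphere" where
  "scale a (Fin x) = Fin (a * x)"
| "scale a Infty = Infty"

definition euclidean_circle :: "complex \<Rightarrow> real \<Rightarrow> riemann_sphere set" where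
  "euclidean_circle a r = Fin ` sphere a r"

definition straight_line :: "complex \<Rightarrow> complex \<Rightarrow> riemann_sphere set" where
  "straight_line a d = insert Infty (Fin ` range (\<lambda>s::real. a + of_real s * d))"

text \<open>
  \<open>circle_with_center C a\<close>: the set \<open>C\<close> is a Euclidean circle or a line, and \<open>a\<close> is its center.
  Points are not circles, and the center of a line is \<open>Infty\<close>.
\<close>

inductive circle_with_center :: "riemann_sphere set \<Rightarrow> riemann_sphere \<Rightarrow> bool" where
  circle: "r > 0 \<Longrightarrow> circle_with_center (euclidean_circle a r) (Fin a)"
| line: "d \<noteq> 0 \<Longrightarrow> circle_with_center (straight_line a d) Infty"

text \<open>\<open>tangent C z v\<close>: the vector \<open>v \<noteq> 0\<close> spans the tangent direction of \<open>C\<close> at its point \<open>z\<close>.\<close>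

inductive tangent :: "riemann_sphere set \<Rightarrow> complex \<Rightarrow> complex \<Rightarrow> bool" where
  circle: "r > 0 \<Longrightarrow> z \<in> sphere a r \<Longrightarrow> v \<noteq> 0 \<Longrightarrow> v \<bullet> (z - a) = 0 \<Longrightarrow>
    tangent (euclidean_circle a r) z v"
| line: "v \<noteq> 0 \<Longrightarrow> tangent (straight_line z v) z v"

text \<open>
  Circles or lines meeting at a right angle do so at all their common points, and at least one
  of these is finite.
\<close>

definition meet_orthogonally :: "riemann_sphere set \<Rightarrow> riemann_sphere set \<Rightarrow> bool" where
  "meet_orthogonally C D \<longleftrightarrow> (\<exists>z v w. tangent C z v \<and> tangent D z w \<and> v \<bullet> w = 0)"

text \<open>
  Patterns are considered on the finitely many rows where they exist: the points \<open>p i j\<close> with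
  \<open>0 \<le> j \<le> n\<close>, the circles \<open>c i j\<close> and centers \<open>t i j\<close> with \<open>0 \<le> j < n\<close>. Other values of
  \<open>p\<close>, \<open>c\<close>, \<open>t\<close> are irrelevant.
\<close>

definition circle_pattern ::
  "nat \<Rightarrow> (int \<Rightarrow> nat \<Rightarrow> riemann_sphere) \<Rightarrow> (int \<Rightarrow> nat \<Rightarrow> riemann_sphere set) \<Rightarrow>
    (int \<Rightarrow> nat \<Rightarrow> riemann_sphere) \<Rightarrow> bool" where
  "circle_pattern n p c t \<longleftrightarrow>
    (\<forall>i. \<forall>j<n. circle_with_center (c i j) (t i j) \<and>
      {p i j, p (i + 1) j, p (i + 1) (j + 1), p i (j + 1)} \<subseteq> c i j)"

definition orthogonal_circles :: "nat \<Rightarrow> (int \<Rightarrow> nat \<Rightarrow> riemann_sphere set) \<Rightarrow> bool" where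
  "orthogonal_circles n c \<longleftrightarrow>
    (\<forall>i. \<forall>j<n. meet_orthogonally (c i j) (c (i + 1) j)) \<and>
    (\<forall>i j. j + 1 < n \<longrightarrow> meet_orthogonally (c i j) (c i (j + 1)))"

definition closed_pattern ::
  "nat \<Rightarrow> nat \<Rightarrow> (int \<Rightarrow> nat \<Rightarrow> riemann_sphere) \<Rightarrow> (int \<Rightarrow> nat \<Rightarrow> riemann_sphere set) \<Rightarrow> bool" where
  "closed_pattern m n p c \<longleftrightarrow>
    (\<forall>i. \<forall>j\<le>n. p (i + int m) j = p i j) \<and> (\<forall>i. \<forall>j<n. c (i + int m) j = c i j)"

text \<open>
  For an orthogonal circle pattern, the following says that the rows up to \<open>n\<close> arise from
  the rows \<open>0\<close> and \<open>1\<close> (points and circles) by well-defined propagation steps.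
  Because \<open>p i j \<noteq> p (i + 1) j\<close>, there is only one circle \<open>c i j\<close> through these two points
  orthogonal to \<open>c i (j - 1)\<close>. The orthogonal circles \<open>c (i - 1) j\<close> and \<open>c i j\<close> meet in exactly
  two points, \<open>p i j\<close> is one of them, and \<open>p i (j + 1)\<close> is the other one.
  In terms of finite points and centers, these two steps solve the cross-ratio \<open>-1\<close> equation for
  \<open>t i j\<close> given \<open>t i (j - 1)\<close>, \<open>p i j\<close>, \<open>p (i + 1) j\<close>, and for \<open>p i (j + 1)\<close> given
  \<open>p i j\<close>, \<open>t (i - 1) j\<close>, \<open>t i j\<close>. Unlike that equation, the geometric steps also make sense when
  points at infinity occur.

  Distinctness of horizontal neighbours is required neither in row \<open>0\<close>, which may be constant
  (its circles are part of the initial data), nor in the last row \<open>n\<close>.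
\<close>

definition propagated_up_to :: "nat \<Rightarrow> (int \<Rightarrow> nat \<Rightarrow> riemann_sphere) \<Rightarrow> bool" where
  "propagated_up_to n p \<longleftrightarrow>
    (\<forall>i j. 1 \<le> j \<and> j < n \<longrightarrow> p i j \<noteq> p (i + 1) j) \<and>
    (\<forall>i. \<forall>j<n. p i (j + 1) \<noteq> p i j)"

end

theory Submission
  imports Defs
begin

text \<open>
  In the coordinate \<open>w = 1 / z\<close> row 0 is at infinity and its circles become lines, consecutive ones
  perpendicular; hence \<open>m\<close> is even, and with \<open>T i = 1 / t i 0\<close> (the reflection of 0 in the \<open>i\<close>-th
  line) row 1 is \<open>S i = (T (i - 1) + T i) / 2\<close>. Sending \<open>p i j\<close> to infinity turns the four circles
  through it into the sides of a rectangle whose vertices are the four neighbours of \<open>p i j\<close>; this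
  is Wynn's cross rule for the epsilon algorithm. So row \<open>k + 1\<close> is the Shanks transform of order \<open>k\<close>
  of the sequence \<open>S\<close>, given by the polynomials orthogonal with respect to the moments
  \<open>S (n + 1) - S n\<close>. For \<open>k = m - 2\<close> this polynomial is \<open>(x ^ m - 1) / (x ^ 2 - 1)\<close>, since applied to
  the shift operator it annihilates these moments, and it sends \<open>S\<close> to a multiple of the mean of \<open>T\<close>.
  The distinctness conditions of the propagation make exactly the required Hankel
  determinants non-zero.
\<close>

section \<open>Orthogonal polynomials of a moment sequence\<close>

text \<open>\<open>act p s n\<close> is the value at \<open>n\<close> of \<open>p(E) s\<close>, where \<open>E\<close> is the shift operator.\<close>

definition act :: "complex poly \<Rightarrow> (int \<Rightarrow> complex) \<Rightarrow> int \<Rightarrow> complex" where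
  "act p s n = (\<Sum>l\<le>degree p. coeff p l * s (n + int l))"

lemma act_eq_sum:
  assumes "degree p \<le> N"
  shows "act p s n = (\<Sum>l\<le>N. coeff p l * s (n + int l))"
  unfolding act_def using assms
  by (intro sum.mono_neutral_left) (auto simp: coeff_eq_0)

lemma act_add: "act (p + q) s n = act p s n + act q s n"
proof -
  define N where "N = max (degree p) (degree q)"
  have "degree (p + q) \<le> N" "degree p \<le> N" "degree q \<le> N"
    unfolding N_def by (auto intro: degree_add_le_max)
  then show ?thesis
    by (simp add: act_eq_sum[of _ N] sum.distrib algebra_simps)
qed

lemma act_smult: "act (smult a p) s n = a * act p s n"
  using act_eq_sum[of "smult a p" "degree p"] degree_smult_le[of a p]
  by (simp add: act_def sum_distrib_left mult.assoc)

lemma act_diff: "act (p - q) s n = act p s n - act q s n"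
  using act_add[of p "- q" s n] act_smult[of "-1" q s n] by simp

lemma act_monom: "act (monom 1 k) s n = s (n + int k)"
  by (simp add: act_eq_sum[OF degree_monom_le] if_distrib[of "\<lambda>x. x * _"] cong: if_cong)

lemma act_pCons: "act (pCons 0 p) s n = act p s (n + 1)"
proof -
  have "act (pCons 0 p) s n = (\<Sum>l\<le>Suc (degree p). coeff (pCons 0 p) l * s (n + int l))"
    by (rule act_eq_sum) (rule degree_pCons_le)
  also have "\<dots> = (\<Sum>l\<le>degree p. coeff p l * s (n + 1 + int l))"
    by (subst sum.atMost_Suc_shift) (simp add: algebra_simps)
  finally show ?thesis by (simp add: act_def)
qed

lemma act_shift: "act p s (n + 1) = act p s n + act p (\<lambda>l. s (l + 1) - s l) n"
  by (simp add: act_def sum.distrib[symmetric] algebra_simps)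

text \<open>\<open>p(E)\<close> and \<open>q(E)\<close> commute, being polynomials in the same shift
  operator.\<close>

lemma act_act:
  "(\<Sum>l\<le>degree p. coeff p l * act q s (n + int l)) =
   (\<Sum>l\<le>degree q. coeff q l * act p s (n + int l))"
proof -
  have "(\<Sum>l\<le>degree p. coeff p l * act q s (n + int l)) =
     (\<Sum>l\<le>degree p. \<Sum>k\<le>degree q. coeff q k * (coeff p l * s (n + int k + int l)))"
    by (simp add: act_def sum_distrib_left algebra_simps)
  also have "\<dots> = (\<Sum>k\<le>degree q. \<Sum>l\<le>degree p. coeff q k * (coeff p l * s (n + int k + int l)))"
    by (rule sum.swap)
  also have "\<dots> = (\<Sum>l\<le>degree q. coeff q l * act p s (n + int l))"
    by (simp add: act_def sum_distrib_left algebra_simps)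
  finally show ?thesis .
qed

text \<open>
  For the functional \<open>L\<^sub>n\<close> with moments \<open>L\<^sub>n(x ^ s) = u (n + s)\<close>, the value \<open>L\<^sub>n(x ^ s * q)\<close> is
  \<open>act q u (n + s)\<close>. The recursion is that of the quotient-difference algorithm.
\<close>

context
  fixes u :: "int \<Rightarrow> complex"
begin

primrec orth_poly :: "nat \<Rightarrow> int \<Rightarrow> complex poly" where
  "orth_poly 0 = (\<lambda>n. 1)"
| "orth_poly (Suc k) = (\<lambda>n. pCons 0 (orth_poly k (n + 1)) -
     smult (act (orth_poly k (n + 1)) u (n + 1 + int k) / act (orth_poly k n) u (n + int k))
       (orth_poly k n))"

text \<open>The squared norm of the \<open>k\<close>-th orthogonal polynomial; when the lower ones
  are non-zero, a quotient of consecutive Hankel determinants.\<close>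

definition hnorm :: "nat \<Rightarrow> int \<Rightarrow> complex" where
  "hnorm k n = act (orth_poly k n) u (n + int k)"

lemma orth_poly_Suc:
  "orth_poly (Suc k) n =
     pCons 0 (orth_poly k (n + 1)) - smult (hnorm k (n + 1) / hnorm k n) (orth_poly k n)"
  by (simp add: hnorm_def)

lemma orth_poly_monic: "degree (orth_poly k n) \<le> k \<and> coeff (orth_poly k n) k = 1"
proof (induction k arbitrary: n)
  case (Suc k)
  have "degree (orth_poly (Suc k) n) \<le> Suc k"
    unfolding orth_poly_Suc
    using Suc[of n] Suc[of "n+1"]
    by (intro degree_diff_le) (auto intro: order.trans[OF degree_pCons_le] order.trans[OF degree_smult_le])
  moreover have "coeff (orth_poly k n) (Suc k) = 0"
    using Suc[of n] by (intro coeff_eq_0) auto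
  ultimately show ?case
    using Suc[of "n+1"] by (simp add: orth_poly_Suc del: orth_poly.simps)
qed simp

lemma degree_orth_poly: "degree (orth_poly k n) = k"
  using orth_poly_monic[of k n] by (intro antisym le_degree) auto

lemma orth_poly_orthogonal:
  assumes "\<And>l n. l < k \<Longrightarrow> hnorm l n \<noteq> 0" "s < k"
  shows "act (orth_poly k n) u (n + int s) = 0"
  using assms
proof (induction k arbitrary: n s)
  case (Suc k)
  have eq: "act (orth_poly (Suc k) n) u (n + int s) =
     act (orth_poly k (n + 1)) u ((n + 1) + int s)
     - hnorm k (n + 1) / hnorm k n * act (orth_poly k n) u (n + int s)"
    by (simp add: orth_poly_Suc act_diff act_smult act_pCons algebra_simps del: orth_poly.simps)
  show ?case
  proof (cases "s < k")
    case True
    then show ?thesis unfolding eq using Suc by simp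
  next
    \<comment> \<open>For \<open>s = k\<close> the factor in the recursion is the one that makes the
      two terms cancel.\<close>
    case False
    then have "s = k" using Suc.prems by simp
    then show ?thesis unfolding eq using Suc.prems(1)[of k n]
      by (simp flip: hnorm_def)
  qed
qed simp

text \<open>If \<open>g\<close> had degree \<open>d < k\<close>, its pairing with
  \<open>orth_poly d n\<close> would be its leading coefficient times \<open>hnorm d n\<close> by
  orthogonality, and 0 by the hypothesis on \<open>g\<close>.\<close>

lemma orthogonal_to_all_eq_0:
  assumes h: "\<And>l n. l < k \<Longrightarrow> hnorm l n \<noteq> 0"
    and g: "\<And>s. s < k \<Longrightarrow> act g u (n + int s) = 0"
    and deg: "\<And>l. l \<ge> k \<Longrightarrow> coeff g l = 0"
  shows "g = 0"
proof (rule ccontr)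
  assume "g \<noteq> 0"
  define d where "d = degree g"
  have lead: "coeff g d \<noteq> 0" using \<open>g \<noteq> 0\<close> by (simp add: d_def)
  then have d: "d < k" using deg[of d] by (meson not_less)
  have "0 = (\<Sum>l\<le>degree (orth_poly d n). coeff (orth_poly d n) l * act g u (n + int l))"
    using d by (simp add: degree_orth_poly g)
  also have "\<dots> = (\<Sum>l\<le>d. coeff g l * act (orth_poly d n) u (n + int l))"
    by (subst act_act) (simp add: d_def)
  also have "\<dots> = (\<Sum>l\<in>{d}. coeff g l * act (orth_poly d n) u (n + int l))"
    using d h by (intro sum.mono_neutral_right) (auto simp: orth_poly_orthogonal)
  also have "\<dots> = coeff g d * hnorm d n" by (simp add: hnorm_def)
  finally show False using lead h[OF d] by simp
qed

lemma orth_poly_eqI: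
  assumes h: "\<And>l n. l < k \<Longrightarrow> hnorm l n \<noteq> 0"
    and "degree r \<le> k" "coeff r k = 1" "\<And>s. s < k \<Longrightarrow> act r u (n + int s) = 0"
  shows "orth_poly k n = r"
proof -
  have "r - orth_poly k n = 0"
  proof (rule orthogonal_to_all_eq_0[OF h, where n = n])
    fix l assume "k \<le> l"
    then show "coeff (r - orth_poly k n) l = 0"
      using assms(2,3) orth_poly_monic[of k n] by (cases "k = l") (auto simp: coeff_eq_0)
  qed (use assms in \<open>auto simp: act_diff orth_poly_orthogonal\<close>)
  then show ?thesis by simp
qed

text \<open>Companion of the defining recursion: the right-hand side is monic and, by the choice of
  the factor, orthogonal for the moments starting at \<open>n + 1\<close>, so uniqueness
  applies.\<close>

lemma orth_poly_shift:
  assumes h: "\<And>l n. l \<le> k \<Longrightarrow> hnorm l n \<noteq> 0"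
  shows "orth_poly (Suc k) (n + 1) =
    orth_poly (Suc k) n - smult (hnorm (Suc k) n / hnorm k (n + 1)) (orth_poly k (n + 1))"
proof (rule orth_poly_eqI)
  let ?e = "hnorm (Suc k) n / hnorm k (n + 1)"
  show "degree (orth_poly (Suc k) n - smult ?e (orth_poly k (n + 1))) \<le> Suc k"
    by (intro degree_diff_le) (auto simp: degree_orth_poly intro: order.trans[OF degree_smult_le] simp del: orth_poly.simps)
  have "coeff (orth_poly k (n + 1)) (Suc k) = 0"
    by (intro coeff_eq_0) (simp add: degree_orth_poly)
  then show "coeff (orth_poly (Suc k) n - smult ?e (orth_poly k (n + 1))) (Suc k) = 1"
    using orth_poly_monic[of "Suc k" n] by (simp del: orth_poly.simps)
  fix s assume s: "s < Suc k"
  have eq: "act (orth_poly (Suc k) n) u (n + 1 + int s) = act (orth_poly (Suc k) n) u (n + int (Suc s))"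
    by (simp add: algebra_simps del: orth_poly.simps)
  show "act (orth_poly (Suc k) n - smult ?e (orth_poly k (n + 1))) u (n + 1 + int s) = 0"
  proof (cases "s < k")
    case True
    then show ?thesis using h unfolding act_diff act_smult eq
      by (simp add: orth_poly_orthogonal del: orth_poly.simps of_nat_Suc)
  next
    case False
    then have "s = k" using s by simp
    then show ?thesis using h unfolding act_diff act_smult eq
      by (simp flip: hnorm_def del: orth_poly.simps of_nat_Suc)
  qed
qed (use h in auto)

end

section \<open>The Shanks transform and Wynn's cross rule\<close>

context
  fixes S :: "int \<Rightarrow> complex"
begin

abbreviation (input) "u \<equiv> \<lambda>n. S (n + 1) - S n"

text \<open>Numerator and denominator of the Shanks transform are kept apart as homogeneous
  coordinates, so that its value may be infinite.\<close>

definition shanks_num :: "nat \<Rightarrow> int \<Rightarrow> complex" where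
  "shanks_num k n = act (orth_poly u k n) S n"

definition shanks_den :: "nat \<Rightarrow> int \<Rightarrow> complex" where
  "shanks_den k n = poly (orth_poly u k n) 1"

lemma shanks_0: "shanks_num 0 n = S n" "shanks_den 0 n = 1"
  by (simp_all add: shanks_num_def shanks_den_def act_def)

lemma hnorm_0: "hnorm u 0 n = S (n + 1) - S n"
  by (simp add: hnorm_def act_def)

lemma shanks_Suc:
  "shanks_num (Suc k) n = shanks_num k (n + 1) - hnorm u k (n + 1) / hnorm u k n * shanks_num k n"
  "shanks_den (Suc k) n = shanks_den k (n + 1) - hnorm u k (n + 1) / hnorm u k n * shanks_den k n"
  by (simp_all add: shanks_num_def shanks_den_def orth_poly_Suc act_diff act_smult act_pCons del: orth_poly.simps)

lemma shanks_shift: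
  assumes h: "\<And>l n. l \<le> k \<Longrightarrow> hnorm u l n \<noteq> 0"
  shows "shanks_num (Suc k) (n + 1) = shanks_num (Suc k) n - hnorm u (Suc k) n / hnorm u k (n + 1) * shanks_num k (n + 1)"
    "shanks_den (Suc k) (n + 1) = shanks_den (Suc k) n - hnorm u (Suc k) n / hnorm u k (n + 1) * shanks_den k (n + 1)"
proof -
  have shift: "orth_poly u (Suc k) (n + 1) = orth_poly u (Suc k) n -
      smult (hnorm u (Suc k) n / hnorm u k (n + 1)) (orth_poly u k (n + 1))"
    using h by (rule orth_poly_shift)
  \<comment> \<open>Orthogonality to the constant 1 says that this polynomial, applied to
    \<open>S\<close>, takes the same value at \<open>n\<close> and \<open>n + 1\<close>.\<close>
  have "act (orth_poly u (Suc k) n) u (n + int 0) = 0"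
    using h by (intro orth_poly_orthogonal) auto
  then have "act (orth_poly u (Suc k) n) S (n + 1) = act (orth_poly u (Suc k) n) S n"
    by (simp add: act_shift del: orth_poly.simps)
  then show "shanks_num (Suc k) (n + 1) = shanks_num (Suc k) n - hnorm u (Suc k) n / hnorm u k (n + 1) * shanks_num k (n + 1)"
    unfolding shanks_num_def shift by (simp add: act_diff act_smult del: orth_poly.simps)
  show "shanks_den (Suc k) (n + 1) = shanks_den (Suc k) n - hnorm u (Suc k) n / hnorm u k (n + 1) * shanks_den k (n + 1)"
    unfolding shanks_den_def shift by (simp del: orth_poly.simps)
qed

text \<open>The determinant detects whether consecutive Shanks transforms coincide. Each of the two
  recursions replaces one of its vectors, and together they multiply it by
  \<open>e * q\<close>.\<close>

lemma det_eq_hnorm: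
  assumes h: "\<And>l n. l < k \<Longrightarrow> hnorm u l n \<noteq> 0"
  shows "shanks_num k (n + 1) * shanks_den k n - shanks_num k n * shanks_den k (n + 1) = hnorm u k n"
  using assms
proof (induction k arbitrary: n)
  case 0
  show ?case by (simp add: shanks_0 hnorm_0)
next
  case (Suc k)
  define e where "e = hnorm u (Suc k) n / hnorm u k (n + 1)"
  define q where "q = hnorm u k (n + 1) / hnorm u k n"
  have shift: "shanks_num (Suc k) (n + 1) = shanks_num (Suc k) n - e * shanks_num k (n + 1)"
    "shanks_den (Suc k) (n + 1) = shanks_den (Suc k) n - e * shanks_den k (n + 1)"
    unfolding e_def by (rule shanks_shift; use Suc.prems in simp)+
  have "shanks_num (Suc k) (n + 1) * shanks_den (Suc k) n - shanks_num (Suc k) n * shanks_den (Suc k) (n + 1)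
    = e * (shanks_den k (n + 1) * shanks_num (Suc k) n - shanks_num k (n + 1) * shanks_den (Suc k) n)"
    by (simp only: shift) (simp add: algebra_simps)
  also have "\<dots> = e * q * (shanks_num k (n + 1) * shanks_den k n - shanks_num k n * shanks_den k (n + 1))"
    unfolding shanks_Suc q_def[symmetric] by (simp add: algebra_simps)
  also have "\<dots> = e * q * hnorm u k n" using Suc by simp
  also have "\<dots> = hnorm u (Suc k) n"
    using Suc.prems[of k n] Suc.prems[of k "n+1"] by (simp add: e_def q_def)
  finally show ?case .
qed

end

text \<open>
  \<open>chart C\<close> is a coordinate in which \<open>C\<close> is the point at infinity; its value at \<open>C\<close> itself is junk.
\<close>

fun chart :: "riemann_sphere \<Rightarrow> riemann_sphere \<Rightarrow> complex" where
  "chart (Fin c) (Fin z) = 1 / (z - c)"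
| "chart (Fin c) Infty = 0"
| "chart Infty (Fin z) = z"
| "chart Infty Infty = 0"

lemma chart_inj: "chart c z = chart c z' \<Longrightarrow> z \<noteq> c \<Longrightarrow> z' \<noteq> c \<Longrightarrow> z = z'"
  by (cases c; cases z; cases z') (auto simp: field_simps)

text \<open>Homogeneous coordinates; the pair \<open>(0, 0)\<close> also gives \<open>Infty\<close>,
  hence the extra cases in \<open>homog_neqD\<close>.\<close>

definition homog :: "complex \<Rightarrow> complex \<Rightarrow> riemann_sphere" where
  "homog x y = (if y = 0 then Infty else Fin (x / y))"

lemma homog_neqD: "homog x y \<noteq> homog x' y' \<Longrightarrow> x' * y - x * y' \<noteq> 0 \<or> (x = 0 \<and> y = 0) \<or> (x' = 0 \<and> y' = 0)"
  by (auto simp: homog_def field_simps split: if_splits)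

lemma homog_eqD: "homog x y = homog x' y' \<Longrightarrow> x' * y - x * y' = 0"
  by (auto simp: homog_def field_simps split: if_splits)

lemma chart_homog:
  assumes "x' * y - x * y' \<noteq> 0"
  shows "chart (homog x y) (homog x' y') =
    (if y = 0 then - x * x' else y * y') / (x' * y - x * y')"
  using assms by (auto simp: homog_def field_simps)

text \<open>A chart value is a linear form divided by the determinant with \<open>(cx, cy)\<close>.
  Expanding \<open>(sx, sy)\<close> and \<open>(ex, ey)\<close> turns both sides into the same sum
  of three fractions.\<close>

lemma cross_rule_lift:
  fixes cx cy :: complex
  assumes s: "sx = cx - q * wx" "sy = cy - q * wy"
    and e: "ex = cx - r * nx" "ey = cy - r * ny"
    and det: "sx * cy - cx * sy = ex * cy - cx * ey" "ex * cy - cx * ey \<noteq> 0"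
  shows "chart (homog cx cy) (homog nx ny) + chart (homog cx cy) (homog sx sy) =
    chart (homog cx cy) (homog ex ey) + chart (homog cx cy) (homog wx wy)"
proof -
  define d where "d = ex * cy - cx * ey"
  define a where "a = nx * cy - cx * ny"
  define b where "b = wx * cy - cx * wy"
  have da: "d = - r * a" unfolding d_def a_def e by (simp add: algebra_simps)
  have db: "d = - q * b" unfolding d_def b_def det(1)[symmetric] s by (simp add: algebra_simps)
  have nz: "a \<noteq> 0" "b \<noteq> 0" "d \<noteq> 0" "r \<noteq> 0" "q \<noteq> 0" using det(2) da db by (auto simp flip: d_def)
  have lin: "ln / a + (lc - q * lw) / d = (lc - r * ln) / d + lw / b" for ln lc lw
  proof -
    have "q * lw / d = - lw / b" "r * ln / d = - ln / a"
      using nz by (simp add: db, simp add: da)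
    then show ?thesis by (simp add: diff_divide_distrib)
  qed
  have ne: "nx * cy - cx * ny \<noteq> 0" "wx * cy - cx * wy \<noteq> 0" "ex * cy - cx * ey \<noteq> 0" "sx * cy - cx * sy \<noteq> 0"
    using nz det(1) by (auto simp: a_def b_def d_def)
  \<comment> \<open>The linear form is \<open>- cx\<close> times the first coordinate if
    \<open>cy = 0\<close>, and \<open>cy\<close> times the second otherwise.\<close>
  show ?thesis
    unfolding chart_homog[OF ne(1)] chart_homog[OF ne(2)] chart_homog[OF ne(3)] chart_homog[OF ne(4)] det(1)
    unfolding a_def[symmetric] b_def[symmetric] d_def[symmetric]
    using lin[of "- cx * nx" "- cx * cx" "- cx * wx"] lin[of "cy * ny" "cy * cy" "cy * wy"]
    by (simp add: s e algebra_simps)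
qed


text \<open>
  The point \<open>p i j\<close> with \<open>j \<ge> 1\<close> is the reciprocal of the Shanks transform of order \<open>l = j - 1\<close> at
  \<open>n = i - l\<close>; the reciprocal puts the denominator first in \<open>homog\<close>.
\<close>

lemma shanks_lift:
  fixes p :: "int \<Rightarrow> nat \<Rightarrow> riemann_sphere" and S :: "int \<Rightarrow> complex"
  defines "h \<equiv> hnorm (\<lambda>n. S (n + 1) - S n)"
  assumes row0: "\<And>i. p i 0 = Fin 0"
    and row1: "\<And>i. recip (p i 1) = Fin (S i)"
    and hor: "\<And>i j. 1 \<le> j \<Longrightarrow> j < N \<Longrightarrow> p i j \<noteq> p (i + 1) j"
    and ver: "\<And>i j. j < N \<Longrightarrow> p i (j + 1) \<noteq> p i j"
    and cross: "\<And>i j. 1 \<le> j \<Longrightarrow> j < N \<Longrightarrow>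
      chart (p i j) (p i (j - 1)) + chart (p i j) (p i (j + 1)) =
      chart (p i j) (p (i + 1) j) + chart (p i j) (p (i - 1) j)"
    and "k < N"
  shows "(\<forall>l<k. \<forall>n. h l n \<noteq> 0) \<and>
    (\<forall>l\<le>k. \<forall>n. p (n + int l) (l + 1) = homog (shanks_den S l n) (shanks_num S l n) \<and>
      (shanks_den S l n \<noteq> 0 \<or> shanks_num S l n \<noteq> 0))"
  using \<open>k < N\<close>
proof (induction k)
  case 0
  have "p n 1 = homog 1 (S n)" for n
    using row1[of n] by (cases "p n 1") (auto simp: homog_def field_simps split: if_splits)
  then show ?case by (simp add: shanks_0)
next
  case (Suc k)
  then have IHh: "\<And>l n. l < k \<Longrightarrow> h l n \<noteq> 0"
    and IHp: "\<And>l n. l \<le> k \<Longrightarrow> p (n + int l) (l + 1) = homog (shanks_den S l n) (shanks_num S l n)"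
    and IHnz: "\<And>l n. l \<le> k \<Longrightarrow> shanks_den S l n \<noteq> 0 \<or> shanks_num S l n \<noteq> 0"
    by auto
  have det: "shanks_num S k (n + 1) * shanks_den S k n - shanks_num S k n * shanks_den S k (n + 1) = h k n" for n
    unfolding h_def by (rule det_eq_hnorm) (use IHh in \<open>simp add: h_def\<close>)
  \<comment> \<open>If it vanished, two horizontal neighbours in row \<open>k + 1\<close> would
    coincide.\<close>
  have hk: "h k n \<noteq> 0" for n
  proof -
    have "p (n + int k) (k + 1) \<noteq> p (n + 1 + int k) (k + 1)"
      using hor[of "k + 1" "n + int k"] Suc.prems by (simp add: algebra_simps)
    then have "homog (shanks_den S k n) (shanks_num S k n) \<noteq> homog (shanks_den S k (n + 1)) (shanks_num S k (n + 1))"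
      unfolding IHp[OF order_refl] .
    from homog_neqD[OF this] show ?thesis
      using det[of n] IHnz[of k n] IHnz[of k "n + 1"] by (auto simp: algebra_simps)
  qed
  have h: "h l n \<noteq> 0" if "l \<le> k" for l n
    using that IHh hk by (cases "l = k") auto
  have step: "p (n + int (Suc k)) (Suc k + 1) = homog (shanks_den S (Suc k) n) (shanks_num S (Suc k) n) \<and>
      (shanks_den S (Suc k) n \<noteq> 0 \<or> shanks_num S (Suc k) n \<noteq> 0)" for n
  proof -
    define i where "i = n + 1 + int k"
    define q where "q = h k (n + 1) / h k n"
    let ?C = "homog (shanks_den S k (n + 1)) (shanks_num S k (n + 1))"
    have C: "p i (k + 1) = ?C"
      unfolding i_def by (rule IHp) simp
    have W: "p (i - 1) (k + 1) = homog (shanks_den S k n) (shanks_num S k n)"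
      using IHp[of k n] by (simp add: i_def)
    have E: "p (i + 1) (k + 1) = homog (shanks_den S k (n + 1 + 1)) (shanks_num S k (n + 1 + 1))"
      using IHp[of k "n + 1 + 1"] by (simp add: i_def algebra_simps)
    have S: "shanks_den S (Suc k) n = shanks_den S k (n + 1) - q * shanks_den S k n"
      "shanks_num S (Suc k) n = shanks_num S k (n + 1) - q * shanks_num S k n"
      unfolding q_def h_def by (rule shanks_Suc)+
    obtain nx ny r where N: "p i k = homog nx ny"
      "shanks_den S k (n + 1 + 1) = shanks_den S k (n + 1) - r * nx"
      "shanks_num S k (n + 1 + 1) = shanks_num S k (n + 1) - r * ny"
    proof (cases k)
      case 0
      \<comment> \<open>The neighbour in row 0 is the origin, with coordinates
        \<open>(0, 1)\<close>; then \<open>r\<close> is forced by the numerators.\<close>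
      show ?thesis
        by (rule that[of 0 1 "S (n + 1) - S (n + 1 + 1)"]) (simp_all add: 0 row0 homog_def shanks_0)
    next
      case (Suc l)
      show ?thesis
      proof (rule that[of "shanks_den S l (n + 1 + 1)" "shanks_num S l (n + 1 + 1)" "h (Suc l) (n + 1) / h l (n + 1 + 1)"])
        show "p i k = homog (shanks_den S l (n + 1 + 1)) (shanks_num S l (n + 1 + 1))"
          using IHp[of l "n + 1 + 1"] Suc by (simp add: i_def algebra_simps)
        show "shanks_den S k (n + 1 + 1) = shanks_den S k (n + 1) - h (Suc l) (n + 1) / h l (n + 1 + 1) * shanks_den S l (n + 1 + 1)"
          "shanks_num S k (n + 1 + 1) = shanks_num S k (n + 1) - h (Suc l) (n + 1) / h l (n + 1 + 1) * shanks_num S l (n + 1 + 1)"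
          unfolding Suc h_def by (rule shanks_shift; use IHh Suc in \<open>simp add: h_def\<close>)+
      qed
    qed
    have detE: "shanks_den S k (n + 1 + 1) * shanks_num S k (n + 1) - shanks_den S k (n + 1) * shanks_num S k (n + 1 + 1) = - h k (n + 1)"
      using det[of "n + 1"] by (simp add: algebra_simps)
    have "shanks_den S (Suc k) n * shanks_num S k (n + 1) - shanks_den S k (n + 1) * shanks_num S (Suc k) n =
        - q * (shanks_num S k (n + 1) * shanks_den S k n - shanks_num S k n * shanks_den S k (n + 1))"
      unfolding S by (simp add: algebra_simps)
    also have "\<dots> = - h k (n + 1)" unfolding det using hk[of n] by (simp add: q_def)
    finally have detS: "shanks_den S (Suc k) n * shanks_num S k (n + 1) - shanks_den S k (n + 1) * shanks_num S (Suc k) n = - h k (n + 1)" .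
    have "chart ?C (homog nx ny) + chart ?C (homog (shanks_den S (Suc k) n) (shanks_num S (Suc k) n)) =
      chart ?C (homog (shanks_den S k (n + 1 + 1)) (shanks_num S k (n + 1 + 1))) + chart ?C (homog (shanks_den S k n) (shanks_num S k n))"
      by (rule cross_rule_lift[OF S N(2,3)]) (simp_all only: detS detE neg_equal_0_iff_equal hk not_False_eq_True)
    moreover have "chart ?C (homog nx ny) + chart ?C (p i (k + 1 + 1)) =
      chart ?C (homog (shanks_den S k (n + 1 + 1)) (shanks_num S k (n + 1 + 1))) + chart ?C (homog (shanks_den S k n) (shanks_num S k n))"
      using cross[of "k + 1" i] Suc.prems unfolding C E W by (simp add: N(1))
    \<comment> \<open>The point and the Shanks value satisfy the same cross rule, so their charts
      agree; both differ from \<open>?C\<close>, where the chart is junk.\<close>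
    ultimately have "chart ?C (p i (k + 1 + 1)) = chart ?C (homog (shanks_den S (Suc k) n) (shanks_num S (Suc k) n))"
      by (metis add_left_cancel)
    moreover have "p i (k + 1 + 1) \<noteq> ?C"
      using ver[of "k + 1" i] Suc.prems C by simp
    moreover have "homog (shanks_den S (Suc k) n) (shanks_num S (Suc k) n) \<noteq> ?C"
    proof
      assume "homog (shanks_den S (Suc k) n) (shanks_num S (Suc k) n) = ?C"
      from homog_eqD[OF this[symmetric]] show False using detS hk by simp
    qed
    ultimately have "p i (k + 1 + 1) = homog (shanks_den S (Suc k) n) (shanks_num S (Suc k) n)"
      by (rule chart_inj)
    moreover have "shanks_den S (Suc k) n \<noteq> 0 \<or> shanks_num S (Suc k) n \<noteq> 0"
      using detS hk[of "n + 1"] by auto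
    ultimately show ?thesis by (simp add: i_def algebra_simps)
  qed
  show ?case
    using h IHp IHnz step by (auto simp: less_Suc_eq_le le_Suc_eq simp del: of_nat_Suc)
qed

section \<open>Periodic sequences and the last row\<close>

lemma sum_periodic_shift:
  fixes f :: "int \<Rightarrow> complex"
  assumes "\<And>i. f (i + int m) = f i"
  shows "(\<Sum>l<m. f (a + int l)) = (\<Sum>l<m. f (int l))"
proof -
  have step: "(\<Sum>l<m. f (b + 1 + int l)) = (\<Sum>l<m. f (b + int l))" for b
  proof -
    have "f b + (\<Sum>l<m. f (b + 1 + int l)) = (\<Sum>l<Suc m. f (b + int l))"
      by (subst sum.lessThan_Suc_shift) (simp add: algebra_simps)
    also have "\<dots> = f b + (\<Sum>l<m. f (b + int l))"
      using assms[of b] by simp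
    finally show ?thesis by simp
  qed
  show ?thesis
  proof (induction a rule: int_induct[where k = 0])
    case (step1 i)
    then show ?case using step[of i] by simp
  next
    case (step2 i)
    then show ?case using step[of "i - 1"] by simp
  qed simp
qed

lemma shanks_periodic:
  fixes p :: "int \<Rightarrow> nat \<Rightarrow> riemann_sphere" and T :: "int \<Rightarrow> complex"
  assumes row0: "\<And>i. p i 0 = Fin 0"
    and row1: "\<And>i. recip (p i 1) = Fin ((T (i - 1) + T i) / 2)"
    and hor: "\<And>i j. 1 \<le> j \<Longrightarrow> j < m - 1 \<Longrightarrow> p i j \<noteq> p (i + 1) j"
    and ver: "\<And>i j. j < m - 1 \<Longrightarrow> p i (j + 1) \<noteq> p i j"
    and cross: "\<And>i j. 1 \<le> j \<Longrightarrow> j < m - 1 \<Longrightarrow>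
      chart (p i j) (p i (j - 1)) + chart (p i j) (p i (j + 1)) =
      chart (p i j) (p (i + 1) j) + chart (p i j) (p (i - 1) j)"
    and T: "\<And>i. T (i + int m) = T i" and "even m" "m > 0"
  shows "p i (m - 1) = recip (Fin ((\<Sum>l<m. T (int l)) / of_nat m))"
proof -
  obtain k where m: "m = 2 * Suc k"
    using \<open>even m\<close> \<open>m > 0\<close> by (metis dvdE mult_is_0 not0_implies_Suc not_gr0)
  define S where "S n = (T (n - 1) + T n) / 2" for n
  define u where "u n = S (n + 1) - S n" for n
  define R :: "nat \<Rightarrow> complex poly" where "R k = (\<Sum>l\<le>k. monom 1 (2 * l))" for k
  have R_Suc: "R (Suc k) = R k + monom 1 (2 * Suc k)" for k
    by (simp add: R_def)
  have R_0: "R 0 = monom 1 0" by (simp add: R_def)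
  have row1': "recip (p i 1) = Fin (S i)" for i unfolding S_def by (rule row1)
  \<comment> \<open>Here \<open>N = m - 1 = 2 * k + 1\<close>, so the order \<open>2 * k\<close> is
    reached, and it describes row \<open>m - 1\<close>.\<close>
  have lift: "(\<forall>l<2 * k. \<forall>n. hnorm u l n \<noteq> 0) \<and>
    (\<forall>l\<le>2 * k. \<forall>n. p (n + int l) (l + 1) = homog (shanks_den S l n) (shanks_num S l n) \<and>
      (shanks_den S l n \<noteq> 0 \<or> shanks_num S l n \<noteq> 0))"
    unfolding u_def by (rule shanks_lift[OF row0 row1' hor ver cross]) (auto simp: m)
  have deg: "degree (R k) \<le> 2 * k"
    unfolding R_def by (intro degree_sum_le) (auto intro: order.trans[OF degree_monom_le])
  have lead: "coeff (R k) (2 * k) = 1"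
    by (simp add: R_def coeff_sum)
  have monom_u: "act (monom 1 k) u n = (T (n + int k + 1) - T (n + int k - 1)) / 2" for k n
    by (simp add: act_monom u_def S_def field_simps)
  \<comment> \<open>Even shifts of \<open>u n = (T (n + 1) - T (n - 1)) / 2\<close> telescope; for
    the \<open>k\<close> with \<open>m = 2 * Suc k\<close> the two ends are one period
    apart.\<close>
  have "act (R k) u n = (T (n + int (2 * k) + 1) - T (n - 1)) / 2" for n k
  proof (induction k)
    case 0
    show ?case unfolding R_0 monom_u by simp
  next
    case (Suc k)
    show ?case unfolding R_Suc act_add monom_u Suc.IH by (simp add: field_simps)
  qed
  moreover have "T (n + int (2 * k) + 1) = T (n - 1)" for n
    using T[of "n - 1"] by (simp add: m algebra_simps)
  ultimately have Ru: "act (R k) u n = 0" for n by (simp only: diff_self div_0)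
  have eq: "orth_poly u (2 * k) n = R k" for n
    using lift deg lead Ru by (intro orth_poly_eqI) auto
  have "poly (R k) 1 = of_nat (Suc k)" for k
    by (induction k) (simp_all add: R_0 R_Suc poly_monom)
  then have shanks_den: "shanks_den S (2 * k) n = of_nat (Suc k)" for n
    using eq by (simp add: shanks_den_def u_def[abs_def])
  \<comment> \<open>Each value of \<open>S\<close> averages two neighbouring values of
    \<open>T\<close>, so even shifts cover a block of consecutive indices exactly once.\<close>
  have "act (R k) S n = (\<Sum>l<2 * Suc k. T (n - 1 + int l)) / 2" for n k
  proof (induction k)
    case 0
    show ?case unfolding R_0 act_monom by (simp add: S_def numeral_2_eq_2)
  next
    case (Suc k)
    show ?case unfolding R_Suc act_add act_monom Suc.IH by (simp add: S_def field_simps)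
  qed
  then have "act (R k) S n = (\<Sum>l<m. T (int l)) / 2" for n
    using sum_periodic_shift[of T m, OF T] by (simp only: m)
  then have shanks_num: "shanks_num S (2 * k) n = (\<Sum>l<m. T (int l)) / 2" for n
    using eq by (simp add: shanks_num_def u_def[abs_def])
  have "p i (m - 1) = homog (of_nat (Suc k)) ((\<Sum>l<m. T (int l)) / 2)"
    using lift[THEN conjunct2, rule_format, of "2 * k" "i - int (2 * k)"] by (simp add: shanks_den shanks_num m del: of_nat_Suc)
  moreover have "complex_of_nat (Suc k) = of_nat m / 2" by (simp add: m)
  moreover have "complex_of_nat m \<noteq> 0" using \<open>m > 0\<close> by simp
  ultimately show ?thesis
    by (simp add: homog_def del: of_nat_Suc)
qed

section \<open>Circles through a point as lines\<close>

text \<open>Circles are bare sets, so the center has to be recovered: \<open>b\<close> is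
  equidistant from the ends of two perpendicular diameters.\<close>

lemma euclidean_circle_center:
  assumes "r > 0" "s > 0" "euclidean_circle a r = euclidean_circle b s"
  shows "a = b"
proof -
  have sub: "dist b z = s" if "dist a z = r" for z
  proof -
    have "Fin z \<in> euclidean_circle a r" using that by (simp add: euclidean_circle_def)
    then have "Fin z \<in> euclidean_circle b s" by (simp only: assms(3))
    then show ?thesis by (auto simp: euclidean_circle_def)
  qed
  have "dist b (a + of_real r) = s" "dist b (a - of_real r) = s"
    "dist b (a + \<i> * of_real r) = s" "dist b (a - \<i> * of_real r) = s"
    by (rule sub; use assms(1) in \<open>simp add: dist_norm norm_mult\<close>)+
  then have "(dist b (a + of_real r))\<^sup>2 = (dist b (a - of_real r))\<^sup>2"
    "(dist b (a + \<i> * of_real r))\<^sup>2 = (dist b (a - \<i> * of_real r))\<^sup>2"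
    by simp_all
  then have "(Re b - Re a - r)^2 = (Re b - Re a + r)^2" "(Im b - Im a - r)^2 = (Im b - Im a + r)^2"
    by (simp_all add: dist_norm cmod_power2 algebra_simps)
  then have "(Re b - Re a) * r = 0" "(Im b - Im a) * r = 0"
    by (auto simp: power2_eq_square algebra_simps)
  then show ?thesis using assms(1) by (simp add: complex_eq_iff)
qed

lemma euclidean_circle_ne_line [simp]: "euclidean_circle a r \<noteq> straight_line b d"
  "straight_line b d \<noteq> euclidean_circle a r"
  by (auto simp: euclidean_circle_def straight_line_def)

lemma tangent_circle:
  assumes "tangent (euclidean_circle a r) z v" "r > 0"
  shows "dist a z = r \<and> v \<noteq> 0 \<and> v \<bullet> (z - a) = 0"
  using assms(1)
proof cases
  case (circle r' a')
  then have "a = a'" using assms(2) by (intro euclidean_circle_center[of r r' a a']) auto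
  moreover have "Fin z \<in> euclidean_circle a r"
    unfolding circle(1) using circle by (simp add: euclidean_circle_def)
  then have "dist a z = r" by (auto simp: euclidean_circle_def)
  ultimately show ?thesis using circle by auto
qed simp

text \<open>The rule for \<open>tangent\<close> presents the line by \<open>z\<close> and
  \<open>v\<close>; that \<open>z\<close> and \<open>z + v\<close> lie on it expresses both through
  \<open>b\<close> and \<open>d\<close>.\<close>

lemma tangent_line:
  assumes "tangent (straight_line b d) z v"
  shows "\<exists>s k. z = b + of_real s * d \<and> v = of_real k * d \<and> v \<noteq> 0"
  using assms
proof cases
  case line
  then have "Fin (z + of_real 0 * v) \<in> straight_line b d" "Fin (z + of_real 1 * v) \<in> straight_line b d"
    unfolding straight_line_def by blast+
  then have "\<exists>s. z = b + of_real s * d" "\<exists>s. z + v = b + of_real s * d"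
    by (auto simp: straight_line_def)
  then obtain s s' where "z = b + of_real s * d" "z + v = b + of_real s' * d"
    by blast
  then have "z = b + of_real s * d" "v = of_real (s' - s) * d" by (auto simp: algebra_simps)
  then show ?thesis using line by blast
qed simp


lemma meet_orthogonally_sym: "meet_orthogonally X Y \<Longrightarrow> meet_orthogonally Y X"
  unfolding meet_orthogonally_def by (metis inner_commute)

text \<open>
  In \<open>chart C\<close>, the circle \<open>X\<close> through \<open>C\<close> becomes the line \<open>\<alpha> + Re (b * w) = 0\<close>. The factors in
  \<open>b\<close> are chosen so that perpendicular circles have perpendicular \<open>b\<close> in all three cases.
\<close>

definition normal :: "riemann_sphere set \<Rightarrow> riemann_sphere \<Rightarrow> complex \<Rightarrow> real \<Rightarrow> bool" where
  "normal X C b \<alpha> \<longleftrightarrow>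
    (\<exists>a r c. r > 0 \<and> X = euclidean_circle a r \<and> C = Fin c \<and> dist a c = r \<and> b = 2 * (c - a) \<and> \<alpha> = 1) \<or>
    (\<exists>a d c. d \<noteq> 0 \<and> X = straight_line a d \<and> C = Fin c \<and> C \<in> X \<and> b = \<i> * d \<and> \<alpha> = 0) \<or>
    (\<exists>a d. d \<noteq> 0 \<and> X = straight_line a d \<and> C = Infty \<and> b = cnj (\<i> * d) \<and> \<alpha> = - Re (b * a))"

lemma normal_exists:
  assumes "circle_with_center X t" "C \<in> X"
  shows "\<exists>b \<alpha>. normal X C b \<alpha>"
  using assms(1)
proof cases
  case (circle r a)
  then obtain c where "C = Fin c" "dist a c = r"
    using assms(2) by (auto simp: euclidean_circle_def)
  then show ?thesis using circle unfolding normal_def by metis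
next
  case (line d a)
  then show ?thesis using assms(2) unfolding normal_def by (cases C) blast+
qed

lemma normal_nonzero: "normal X C b \<alpha> \<Longrightarrow> b \<noteq> 0"
  by (auto simp: normal_def)

lemma normal_equation:
  assumes "normal X C b \<alpha>" "Z \<in> X" "Z \<noteq> C"
  shows "\<alpha> + Re (b * chart C Z) = 0"
  using assms(1) unfolding normal_def
proof (elim disjE exE conjE)
  fix a r c assume *: "r > 0" "X = euclidean_circle a r" "C = Fin c" "dist a c = r" "b = 2 * (c - a)" "\<alpha> = 1"
  obtain z where "Z = Fin z" "dist a z = r"
    using assms(2) *(2) by (auto simp: euclidean_circle_def)
  then have z: "Z = Fin z" "dist a z = r" "z \<noteq> c" using assms(3) *(3) by auto
  define w where "w = z - c"
  have w: "w \<noteq> 0" using z by (simp add: w_def)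
  have "(norm (a - z))\<^sup>2 = (norm (a - c))\<^sup>2" using z * by (simp add: dist_norm)
  then have "(Re (c - a) + Re w)^2 + (Im (c - a) + Im w)^2 = (Re (c - a))^2 + (Im (c - a))^2"
    by (simp add: cmod_power2 w_def power2_commute)
  \<comment> \<open>Division by the squared norm of \<open>w\<close> turns this into the line
    equation at \<open>1 / w\<close>.\<close>
  then have "(Re w)^2 + (Im w)^2 + 2 * (Re (c - a) * Re w + Im (c - a) * Im w) = 0"
    by (simp add: power2_eq_square algebra_simps)
  moreover have "(Re w)^2 + (Im w)^2 \<noteq> 0" using w by (simp add: complex_eq_iff sum_power2_eq_zero_iff)
  moreover have "Re (b * (1 / w)) = 2 * (Re (c - a) * Re w + Im (c - a) * Im w) / ((Re w)^2 + (Im w)^2)"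
    unfolding * by (simp add: Re_divide algebra_simps add_divide_distrib diff_divide_distrib)
  ultimately have "Re (b * (1 / w)) = - 1" by (simp add: divide_eq_eq)
  moreover have "chart C Z = 1 / w" by (simp add: * z w_def)
  ultimately show ?thesis by (simp only: *(6))
next
  fix a d c assume *: "d \<noteq> 0" "X = straight_line a d" "C = Fin c" "C \<in> X" "b = \<i> * d" "\<alpha> = 0"
  then obtain s where c: "c = a + of_real s * d" by (auto simp: straight_line_def)
  show ?thesis
  proof (cases Z)
    case (Fin z)
    then obtain s' where z: "z = a + of_real s' * d" using assms(2) * by (auto simp: straight_line_def)
    have "b * chart C Z = \<i> * d / (of_real (s' - s) * d)"
      by (simp add: Fin * z c algebra_simps)
    also have "\<dots> = \<i> * of_real (1 / (s' - s))" using * by simp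
    finally show ?thesis using * by (simp only:) simp
  qed (use * in simp)
next
  fix a d assume *: "d \<noteq> 0" "X = straight_line a d" "C = Infty" "b = cnj (\<i> * d)" "\<alpha> = - Re (b * a)"
  obtain s where z: "Z = Fin (a + of_real s * d)" using assms(2,3) * by (auto simp: straight_line_def)
  show ?thesis by (simp add: * z algebra_simps)
qed

section \<open>Perpendicular circles have perpendicular normals\<close>

text \<open>The non-zero \<open>v\<close> lies in the kernel of the matrix with rows
  \<open>x\<close> and \<open>y\<close>, so its determinant vanishes.\<close>

lemma parallel_of_orthogonal:
  fixes x y v :: complex
  assumes "v \<bullet> x = 0" "v \<noteq> 0" "v \<bullet> y = 0"
  shows "Re x * Im y - Im x * Re y = 0"
proof -
  have 1: "Re v * Re x + Im v * Im x = 0" "Re v * Re y + Im v * Im y = 0"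
    using assms by (simp_all add: inner_complex_def)
  then have "Re v * (Re x * Im y - Im x * Re y) = 0" "Im v * (Re x * Im y - Im x * Re y) = 0"
    by algebra+
  then show ?thesis using assms(2) by (auto simp: complex_eq_iff)
qed

text \<open>The definition grants a right angle at some common point \<open>z\<close>; the law of
  cosines carries it over to \<open>c\<close>.\<close>

lemma meet_orthogonally_circles:
  assumes "meet_orthogonally (euclidean_circle a r) (euclidean_circle b s)" "r > 0" "s > 0"
    and "dist a c = r" "dist b c = s"
  shows "(c - a) \<bullet> (c - b) = 0"
proof -
  obtain z v w where *: "tangent (euclidean_circle a r) z v" "tangent (euclidean_circle b s) z w" "v \<bullet> w = 0"
    using assms(1) by (auto simp: meet_orthogonally_def)
  note t1 = tangent_circle[OF *(1) assms(2)] and t2 = tangent_circle[OF *(2) assms(3)]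
  have "Re (z - a) * Im w - Im (z - a) * Re w = 0"
    using parallel_of_orthogonal[of v "z - a" w] t1 * by simp
  moreover have "Re w * Re (z - b) + Im w * Im (z - b) = 0"
    using t2 by (simp add: inner_complex_def)
  ultimately have "Re w * ((z - a) \<bullet> (z - b)) = 0" "Im w * ((z - a) \<bullet> (z - b)) = 0"
    unfolding inner_complex_def by algebra+
  then have z: "(z - a) \<bullet> (z - b) = 0" using t2 by (auto simp: complex_eq_iff)
  \<comment> \<open>Hence \<open>z - a\<close> and \<open>z - b\<close> have the same inner product for both common points \<open>z\<close> of the circles.\<close>
  have pyth: "(norm (a - b))\<^sup>2 = (norm (x - a))\<^sup>2 + (norm (x - b))\<^sup>2 - 2 * ((x - a) \<bullet> (x - b))" for x :: complex
    by (simp add: power2_norm_eq_inner inner_diff_left inner_diff_right inner_commute)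
  have "norm (x - a) = r \<and> norm (x - b) = s" if "x \<in> {z, c}" for x
    using that t1 t2 assms by (auto simp: dist_norm norm_minus_commute)
  then show ?thesis using pyth[of z] pyth[of c] z by simp
qed

text \<open>Orthogonality forces the center \<open>a\<close> onto the line, so \<open>c - a\<close>
  is parallel to \<open>d\<close>.\<close>

lemma meet_orthogonally_circle_line:
  assumes "meet_orthogonally (euclidean_circle a r) (straight_line b d)" "r > 0" "d \<noteq> 0"
    and "Fin c \<in> straight_line b d"
  shows "(c - a) \<bullet> (\<i> * d) = 0"
proof -
  obtain z v w where *: "tangent (euclidean_circle a r) z v" "tangent (straight_line b d) z w" "v \<bullet> w = 0"
    using assms(1) by (auto simp: meet_orthogonally_def)
  note t = tangent_circle[OF *(1) assms(2)]
  obtain s k where z: "z = b + of_real s * d" "w = of_real k * d" "w \<noteq> 0" using tangent_line[OF *(2)] by blast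
  have "Re (z - a) * Im w - Im (z - a) * Re w = 0"
    using parallel_of_orthogonal[of v "z - a" w] t * by simp
  then have "k * (Re (z - a) * Im d - Im (z - a) * Re d) = 0"
    by (simp add: z(2) algebra_simps)
  then have "Re (z - a) * Im d - Im (z - a) * Re d = 0" using z by auto
  moreover obtain s' where "c = b + of_real s' * d" using assms(4) by (auto simp: straight_line_def)
  ultimately show ?thesis by (simp add: inner_complex_def z(1) algebra_simps)
qed

lemma meet_orthogonally_lines:
  assumes "meet_orthogonally (straight_line a d) (straight_line b e)"
  shows "d \<bullet> e = 0"
proof -
  obtain z v w where *: "tangent (straight_line a d) z v" "tangent (straight_line b e) z w" "v \<bullet> w = 0"
    using assms(1) by (auto simp: meet_orthogonally_def)
  from tangent_line[OF *(1)] tangent_line[OF *(2)] obtain k l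
    where "v = of_real k * d" "v \<noteq> 0" "w = of_real l * e" "w \<noteq> 0" by blast
  then have "k * l * (d \<bullet> e) = 0" "k \<noteq> 0" "l \<noteq> 0"
    using *(3) by (auto simp: inner_complex_def algebra_simps)
  then show ?thesis by simp
qed

lemma normal_orthogonal:
  assumes "meet_orthogonally X Y" "normal X C b \<alpha>" "normal Y C b' \<alpha>'"
  shows "b \<bullet> b' = 0"
proof -
  have inner_scale: "(2 * x) \<bullet> y = 2 * (x \<bullet> y)" "x \<bullet> (2 * y) = 2 * (x \<bullet> y)"
    "(\<i> * x) \<bullet> (\<i> * y) = x \<bullet> y" "cnj x \<bullet> cnj y = x \<bullet> y" for x y :: complex
    by (simp_all add: inner_complex_def algebra_simps)
  note sym = meet_orthogonally_sym[OF assms(1)]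
  show ?thesis
    using assms(2,3) unfolding normal_def
  \<comment> \<open>The initial \<open>simp\<close> removes the cases in which \<open>C\<close>
    would be both finite and \<open>Infty\<close>.\<close>
  proof (elim disjE exE conjE; (simp; fail)?)
    fix a r c a' r' c'
    assume "0 < r" "X = euclidean_circle a r" "C = Fin c" "dist a c = r" "b = 2 * (c - a)"
      and "0 < r'" "Y = euclidean_circle a' r'" "C = Fin c'" "dist a' c' = r'" "b' = 2 * (c' - a')"
    then show ?thesis
      using meet_orthogonally_circles[of a r a' r' c] assms(1)
      by (simp add: inner_scale del: right_diff_distrib_numeral)
  next
    fix a r c a' d c'
    assume "0 < r" "X = euclidean_circle a r" "C = Fin c" "b = 2 * (c - a)"
      and "d \<noteq> 0" "Y = straight_line a' d" "C = Fin c'" "C \<in> Y" "b' = \<i> * d"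
    then show ?thesis
      using meet_orthogonally_circle_line[of a r a' d c] assms(1)
      by (simp add: inner_scale del: right_diff_distrib_numeral)
  next
    fix a d c a' r c'
    assume "d \<noteq> 0" "X = straight_line a d" "C = Fin c" "C \<in> X" "b = \<i> * d"
      and "0 < r" "Y = euclidean_circle a' r" "C = Fin c'" "b' = 2 * (c' - a')"
    then show ?thesis
      using meet_orthogonally_circle_line[of a' r a d c] sym
      by (simp add: inner_scale inner_commute del: right_diff_distrib_numeral)
  next
    fix a d c a' d' c'
    assume "X = straight_line a d" "b = \<i> * d" "Y = straight_line a' d'" "b' = \<i> * d'"
    then show ?thesis
      using meet_orthogonally_lines[of a d a' d'] assms(1) by (simp add: inner_scale)
  next
    fix a d a' d'
    assume "X = straight_line a d" "b = cnj (\<i> * d)" "Y = straight_line a' d'" "b' = cnj (\<i> * d')"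
    then show ?thesis
      using meet_orthogonally_lines[of a d a' d'] assms(1) by (simp only: inner_scale)
  qed
qed

text \<open>\<open>Re (b * x)\<close> is the inner product of \<open>b\<close> with
  \<open>cnj x\<close>, and \<open>b\<close>, \<open>b'\<close> form an orthogonal basis of the
  plane.\<close>

lemma orthogonal_to_basis:
  fixes b b' x :: complex
  assumes "b \<noteq> 0" "b' \<noteq> 0" "b \<bullet> b' = 0" "Re (b * x) = 0" "Re (b' * x) = 0"
  shows "x = 0"
proof (rule ccontr)
  assume "x \<noteq> 0"
  have "b \<bullet> cnj x = 0" "b' \<bullet> cnj x = 0" using assms(4,5) by (simp_all add: inner_complex_def)
  then have "Re b * Im b' - Im b * Re b' = 0"
    using parallel_of_orthogonal[of "cnj x" b b'] \<open>x \<noteq> 0\<close> by (simp add: inner_commute)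
  moreover have "Re b * Re b' + Im b * Im b' = 0" using assms(3) by (simp add: inner_complex_def)
  ultimately have "Re b' * ((Re b)^2 + (Im b)^2) = 0" "Im b' * ((Re b)^2 + (Im b)^2) = 0"
    by algebra+
  then show False using assms(1,2) by (auto simp: complex_eq_iff sum_power2_eq_zero_iff)
qed

text \<open>\<open>a\<close> and \<open>c\<close> are both perpendicular to \<open>b\<close>, hence
  parallel.\<close>

lemma orthogonal_orthogonal:
  fixes a b c x :: complex
  assumes "b \<noteq> 0" "c \<noteq> 0" "a \<bullet> b = 0" "b \<bullet> c = 0" "Re (c * x) = 0"
  shows "Re (a * x) = 0"
proof -
  have "Re a * Im c - Im a * Re c = 0"
    using parallel_of_orthogonal[of b a c] assms by (simp add: inner_commute)
  moreover have "Re c * Re x - Im c * Im x = 0" using assms(5) by simp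
  ultimately have "Re c * Re (a * x) = 0" "Im c * Re (a * x) = 0"
    unfolding times_complex.simps by algebra+
  then show ?thesis using assms(2) by (auto simp: complex_eq_iff)
qed

section \<open>Orthogonal circle patterns\<close>

text \<open>In the chart at \<open>C\<close> the circles become the side lines of a rectangle with
  vertices \<open>N\<close>, \<open>E\<close>, \<open>S\<close>, \<open>W\<close> in this order,
  whose diagonals share their midpoint.\<close>

lemma rectangle_cross_rule:
  assumes circ: "circle_with_center X1 t1" "circle_with_center X2 t2" "circle_with_center X3 t3" "circle_with_center X4 t4"
    and orth: "meet_orthogonally X1 X2" "meet_orthogonally X2 X3" "meet_orthogonally X4 X3" "meet_orthogonally X1 X4"
    and C: "C \<in> X1" "C \<in> X2" "C \<in> X3" "C \<in> X4"
    and N: "N \<in> X1" "N \<in> X2" "N \<noteq> C" and E: "E \<in> X2" "E \<in> X3" "E \<noteq> C"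
    and S: "S \<in> X3" "S \<in> X4" "S \<noteq> C" and W: "W \<in> X4" "W \<in> X1" "W \<noteq> C"
  shows "chart C N + chart C S = chart C E + chart C W"
proof -
  obtain b1 \<alpha>1 b2 \<alpha>2 b3 \<alpha>3 b4 \<alpha>4 where
    n: "normal X1 C b1 \<alpha>1" "normal X2 C b2 \<alpha>2" "normal X3 C b3 \<alpha>3" "normal X4 C b4 \<alpha>4"
    using normal_exists circ C by metis
  note nz = n[THEN normal_nonzero]
  have o: "b1 \<bullet> b2 = 0" "b2 \<bullet> b3 = 0" "b4 \<bullet> b3 = 0" "b1 \<bullet> b4 = 0"
    using normal_orthogonal n orth by blast+
  have diff: "Re (b * (chart C P - chart C Q)) = 0" if "normal X C b \<alpha>" "P \<in> X" "P \<noteq> C" "Q \<in> X" "Q \<noteq> C"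
    for X b \<alpha> P Q
    using normal_equation[OF that(1-3)] normal_equation[OF that(1,4,5)] by (simp add: right_diff_distrib)
  have 1: "Re (b1 * (chart C N - chart C W)) = 0" and 2: "Re (b2 * (chart C N - chart C E)) = 0"
    and 3: "Re (b3 * (chart C S - chart C E)) = 0" and 4: "Re (b4 * (chart C S - chart C W)) = 0"
    using diff n N E S W by blast+
  have "Re (b1 * (chart C S - chart C E)) = 0"
    by (rule orthogonal_orthogonal[OF _ _ o(1,2) 3]) (use nz in auto)
  moreover have "Re (b2 * (chart C S - chart C W)) = 0"
    by (rule orthogonal_orthogonal[OF _ _ _ o(4) 4]) (use nz o in \<open>auto simp: inner_commute\<close>)
  ultimately have "Re (b1 * (chart C N + chart C S - chart C E - chart C W)) = 0"
    "Re (b2 * (chart C N + chart C S - chart C E - chart C W)) = 0"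
    using 1 2 by (simp_all add: algebra_simps)
  then have "chart C N + chart C S - chart C E - chart C W = 0"
    using orthogonal_to_basis nz o by blast
  then show ?thesis by (simp add: algebra_simps)
qed


text \<open>
  Inversion maps the center of a circle to the reflection of the image of \<open>Infty\<close>, here 0, in the image of
  the circle, and the reflection of 0 in the line \<open>\<alpha> + Re (b * w) = 0\<close> is \<open>- 2 * \<alpha> / b\<close>.
\<close>

lemma normal_at_0:
  assumes "circle_with_center X t" "Fin 0 \<in> X"
  obtains b \<alpha> where "normal X (Fin 0) b \<alpha>" "recip t = Fin (- 2 * of_real \<alpha> / b)"
  using assms(1)
proof cases
  case (circle r a)
  then have r: "dist a 0 = r" using assms(2) by (auto simp: euclidean_circle_def)
  have "normal X (Fin 0) (2 * (0 - a)) 1"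
    using circle r unfolding normal_def by blast
  moreover have "a \<noteq> 0" using r circle by auto
  ultimately show thesis using circle by (intro that) auto
next
  case (line d a)
  then have "normal X (Fin 0) (\<i> * d) 0"
    using assms(2) unfolding normal_def by blast
  then show thesis using line by (intro that) auto
qed

text \<open>\<open>closed_pattern\<close> does not mention the centers; this makes them periodic
  along with the circles.\<close>

lemma center_unique:
  assumes "circle_with_center X t" "circle_with_center X t'"
  shows "t = t'"
  using assms by (auto elim!: circle_with_center.cases dest: euclidean_circle_center)


text \<open>Two perpendicular lines meet at the sum of the feet of the perpendiculars from 0, which
  are \<open>- \<alpha> / b\<close> and \<open>- \<alpha>' / b'\<close>; this is the midpoint of the
  two reflections of 0.\<close>

lemma row1_midpoint:
  assumes "normal X (Fin 0) b \<alpha>" "normal Y (Fin 0) b' \<alpha>'" "b \<bullet> b' = 0"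
    and "Z \<in> X" "Z \<in> Y" "Z \<noteq> Fin 0"
  shows "recip Z = Fin ((- 2 * of_real \<alpha> / b + - 2 * of_real \<alpha>' / b') / 2)"
proof -
  have nz: "b \<noteq> 0" "b' \<noteq> 0" using assms normal_nonzero by blast+
  have quot: "Re (x / y) = 0" if "x \<bullet> y = 0" for x y :: complex
    using that by (simp add: Re_divide inner_complex_def)
  have Re_scale: "Re (of_real r * x) = r * Re x" for r x by simp
  define w where "w = chart (Fin 0) Z"
  have "\<alpha> + Re (b * w) = 0" "\<alpha>' + Re (b' * w) = 0"
    unfolding w_def using assms normal_equation by blast+
  moreover have "Re (of_real \<alpha>' * (b / b')) = 0" "Re (of_real \<alpha> * (b' / b)) = 0"
    using quot[of b b'] quot[of b' b] assms(3) by (simp_all only: Re_scale inner_commute mult_zero_right)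
  then have "Re (b * (of_real \<alpha>' / b')) = 0" "Re (b' * (of_real \<alpha> / b)) = 0"
    by (simp_all add: mult.commute)
  ultimately have "Re (b * (w + of_real \<alpha> / b + of_real \<alpha>' / b')) = 0"
    "Re (b' * (w + of_real \<alpha> / b + of_real \<alpha>' / b')) = 0"
    using nz by (simp_all only: distrib_left plus_complex.simps) simp_all
  then have "w + of_real \<alpha> / b + of_real \<alpha>' / b' = 0"
    using orthogonal_to_basis nz assms(3) by blast
  then have "w = - (of_real \<alpha> / b + of_real \<alpha>' / b')"
    by (simp only: eq_neg_iff_add_eq_0 add.assoc)
  then have "w = (- 2 * of_real \<alpha> / b + - 2 * of_real \<alpha>' / b') / 2"
    by (simp add: add_divide_distrib mult.commute)
  moreover have "recip Z = Fin w"
    using assms(6) by (cases Z) (auto simp: w_def)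
  ultimately show ?thesis by simp
qed

text \<open>Directions alternate: every \<open>b (2 * k)\<close> is perpendicular to
  \<open>b 1\<close>. For odd \<open>m\<close> the non-zero \<open>b m\<close> would be both
  parallel and perpendicular to \<open>b 1\<close>.\<close>

lemma even_period_of_orthogonal:
  fixes b :: "nat \<Rightarrow> complex"
  assumes nz: "\<And>i. b i \<noteq> 0" and orth: "\<And>i. b i \<bullet> b (Suc i) = 0"
    and "b m \<bullet> b 1 = 0"
  shows "even m"
proof (rule ccontr)
  assume "odd m"
  then obtain k where k: "m = Suc (2 * k)" by (auto elim: oddE)
  have "b (2 * k) \<bullet> b 1 = 0" for k
  proof (induction k)
    case 0
    show ?case using orth[of 0] by simp
  next
    case (Suc k)
    let ?x = "b (Suc (2 * k))"
    have "Re (b (Suc (2 * k))) * Im (b 1) - Im (b (Suc (2 * k))) * Re (b 1) = 0"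
      using parallel_of_orthogonal[OF orth[of "2 * k"] nz Suc] .
    moreover have "Re ?x * Re (b (2 * Suc k)) + Im ?x * Im (b (2 * Suc k)) = 0"
      using orth[of "Suc (2 * k)"] by (simp add: inner_complex_def)
    ultimately have "Re ?x * (b (2 * Suc k) \<bullet> b 1) = 0" "Im ?x * (b (2 * Suc k) \<bullet> b 1) = 0"
      unfolding inner_complex_def by algebra+
    then show ?case using nz[of "Suc (2 * k)"] by (auto simp: complex_eq_iff)
  qed
  then have "b 1 \<bullet> b (2 * k) = 0" by (simp add: inner_commute)
  moreover have "b (2 * k) \<bullet> b m = 0" using orth[of "2 * k"] k by simp
  ultimately have "Re (b 1) * Im (b m) - Im (b 1) * Re (b m) = 0"
    using parallel_of_orthogonal[of "b (2 * k)" "b 1" "b m"] nz by (simp add: inner_commute)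
  moreover have "Re (b m) * Re (b 1) + Im (b m) * Im (b 1) = 0"
    using assms(3) by (simp add: inner_complex_def)
  ultimately have "Re (b m) * ((Re (b 1))^2 + (Im (b 1))^2) = 0" "Im (b m) * ((Re (b 1))^2 + (Im (b 1))^2) = 0"
    by algebra+
  then show False using nz[of m] nz[of 1] by (auto simp: complex_eq_iff sum_power2_eq_zero_iff)
qed

lemma sum_Fin: "(\<Sum>l<m. Fin (f l)) = Fin (\<Sum>l<(m::nat). f l)"
  by (induction m) (simp_all add: zero_riemann_sphere_def)

theorem corollary6p18:
  fixes m n :: nat
    and p t :: "int \<Rightarrow> nat \<Rightarrow> riemann_sphere"
    and c :: "int \<Rightarrow> nat \<Rightarrow> riemann_sphere set"
  assumes "m \<ge> 1"
    and "n = max 1 (m - 1)" \<comment> \<open>row 1 belongs to the initial data, also for m = 1\<close>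
    and "circle_pattern n p c t"
    and "orthogonal_circles n c"
    and "closed_pattern m n p c"
    and "\<forall>i. p i 0 = Fin 0"
    and "propagated_up_to n p"
  shows "\<forall>i. p i (m - 1) = recip (scale (1 / of_nat m) (\<Sum>l<m. recip (p (int l) 1))) \<and>
             p i (m - 1) = recip (scale (1 / of_nat m) (\<Sum>l<m. recip (t (int l) 0)))"
proof -
  have n: "0 < n" using assms(2) by simp
  have circ: "circle_with_center (c i j) (t i j)"
    and pts: "p i j \<in> c i j" "p (i + 1) j \<in> c i j" "p (i + 1) (j + 1) \<in> c i j" "p i (j + 1) \<in> c i j"
    if "j < n" for i j
    using assms(3) that unfolding circle_pattern_def by auto
  have orthh: "meet_orthogonally (c i j) (c (i + 1) j)" if "j < n" for i j
    using assms(4) that unfolding orthogonal_circles_def by blast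
  have orthv: "meet_orthogonally (c i j) (c i (j + 1))" if "j + 1 < n" for i j
    using assms(4) that unfolding orthogonal_circles_def by blast
  have row0: "p i 0 = Fin 0" for i using assms(6) by simp
  have hor: "p i j \<noteq> p (i + 1) j" if "1 \<le> j" "j < n" for i j
    using assms(7) that unfolding propagated_up_to_def by blast
  have ver: "p i (j + 1) \<noteq> p i j" if "j < n" for i j
    using assms(7) that unfolding propagated_up_to_def by blast
  have per: "c (i + int m) 0 = c i 0" for i
    using assms(5) n unfolding closed_pattern_def by blast
  have "\<exists>b \<alpha>. normal (c i 0) (Fin 0) b \<alpha> \<and> recip (t i 0) = Fin (- 2 * of_real \<alpha> / b)" for i
    using normal_at_0[OF circ[OF n, of i]] pts(1)[OF n, of i] row0 by metis
  then obtain b \<alpha> where normal: "\<And>i. normal (c i 0) (Fin 0) (b i) (\<alpha> i)"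
    and center: "\<And>i. recip (t i 0) = Fin (- 2 * of_real (\<alpha> i) / b i)"
    by metis
  \<comment> \<open>This is \<open>1 / t i 0\<close>, read as 0 when the circle is a line.\<close>
  define T where "T i = - 2 * of_real (\<alpha> i) / b i" for i
  have orth_b: "b i \<bullet> b (i + 1) = 0" for i
    using normal_orthogonal[OF orthh[OF n] normal normal] .
  have "even m"
  proof (rule even_period_of_orthogonal[where b = "\<lambda>i. b (int i)"])
    show "b (int i) \<noteq> 0" for i using normal_nonzero[OF normal] .
    show "b (int i) \<bullet> b (int (Suc i)) = 0" for i using orth_b[of "int i"] by (simp add: add.commute)
    \<comment> \<open>The \<open>b i\<close> are chosen separately for each \<open>i\<close>, so the
      period enters through the circles.\<close>
    have "meet_orthogonally (c (int m) 0) (c 1 0)"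
      using orthh[OF n, of 0] per[of 0] by simp
    from normal_orthogonal[OF this normal normal] show "b (int m) \<bullet> b (int 1) = 0" by simp
  qed
  \<comment> \<open>As 1 is odd, \<open>m\<close> is at least 2 and the maximum defining
    \<open>n\<close> is \<open>m - 1\<close>.\<close>
  with assms(1,2) have nm: "n = m - 1" by (cases "m = 1") auto
  have T_per: "T (i + int m) = T i" for i
  proof -
    have "t (i + int m) 0 = t i 0"
      using center_unique circ[OF n] per by metis
    then show ?thesis using center[of i] center[of "i + int m"] by (simp add: T_def)
  qed
  have row1: "recip (p i 1) = Fin ((T (i - 1) + T i) / 2)" for i
    unfolding T_def
  proof (rule row1_midpoint[OF normal normal])
    show "b (i - 1) \<bullet> b i = 0" using orth_b[of "i - 1"] by simp
    show "p i 1 \<in> c (i - 1) 0" "p i 1 \<in> c i 0"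
      using pts(3)[OF n, of "i - 1"] pts(4)[OF n, of i] by simp_all
    show "p i 1 \<noteq> Fin 0" using ver[OF n, of i] row0 by simp
  qed
  have cross: "chart (p i j) (p i (j - 1)) + chart (p i j) (p i (j + 1)) =
      chart (p i j) (p (i + 1) j) + chart (p i j) (p (i - 1) j)" if j: "1 \<le> j" "j < n" for i j
  proof -
    obtain k where k: "j = k + 1" using j(1) by (metis add.commute le_Suc_ex)
    then have kn: "k < n" using j by simp
    note pts' = pts[OF j(2), of i] pts[OF j(2), of "i - 1"] pts[OF kn, of i] pts[OF kn, of "i - 1"]
    show ?thesis
    \<comment> \<open>The circles are listed cyclically around \<open>p i j\<close>, so that
      \<open>N\<close>, \<open>E\<close>, \<open>S\<close>, \<open>W\<close> become
      \<open>p i (j - 1)\<close>, \<open>p (i + 1) j\<close>, \<open>p i (j + 1)\<close>,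
      \<open>p (i - 1) j\<close>.\<close>
    proof (rule rectangle_cross_rule[of "c (i - 1) k" _ "c i k" _ "c i j" _ "c (i - 1) j"])
      show "meet_orthogonally (c (i - 1) k) (c i k)" using orthh[OF kn, of "i - 1"] by simp
      show "meet_orthogonally (c (i - 1) j) (c i j)" using orthh[OF j(2), of "i - 1"] by simp
      show "meet_orthogonally (c i k) (c i j)" "meet_orthogonally (c (i - 1) k) (c (i - 1) j)"
        using orthv j k by simp_all
      show "p i (j - 1) \<noteq> p i j" using ver[OF kn, of i] k by simp
      show "p (i - 1) j \<noteq> p i j" using hor[OF j, of "i - 1"] by simp
    qed (use circ[OF j(2)] circ[OF kn] pts' k hor[OF j, of i] ver[OF j(2), of i] in auto)
  qed
  have row: "p i (m - 1) = recip (Fin ((\<Sum>l<m. T (int l)) / of_nat m))" for i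
    by (rule shanks_periodic[OF row0 row1 hor ver cross T_per \<open>even m\<close>])
      (use assms(1) nm in auto)
  have "(\<Sum>l<m. recip (t (int l) 0)) = Fin (\<Sum>l<m. T (int l))"
    by (simp add: center[folded T_def] sum_Fin)
  moreover have "(\<Sum>l<m. recip (p (int l) 1)) = Fin (\<Sum>l<m. T (int l))"
  proof -
    \<comment> \<open>Each \<open>T\<close> enters two consecutive midpoints with weight one half,
      so over a period both sums of reciprocals agree.\<close>
    have "(\<Sum>l<m. T (int l - 1)) = (\<Sum>l<m. T (int l))"
      using sum_periodic_shift[of T m "-1", OF T_per] by (simp add: algebra_simps)
    then have "(\<Sum>l<m. (T (int l - 1) + T (int l)) / 2) = (\<Sum>l<m. T (int l))"
      by (simp add: sum.distrib flip: sum_divide_distrib)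
    then show ?thesis unfolding row1 sum_Fin by simp
  qed
  ultimately show ?thesis using row by simp
qed

end
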